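(* Let $A\in\mathbb{R}^{m\times n}$ with $m<n$ have full row rank and let $b\in\mathbb{R}^m$ be nonzero (and in the range of $A$). Define $$\alpha^*=\min\{\|v\|_1^2:\ v\in\mathbb{R}^n,\ \|v\|_2=1,\ Av=0\}$$ and, for $\alpha\in\mathbb{R}$, $$F(\alpha)=\inf\{\|x\|_1^2-\alpha\|x\|_2^2:\ Ax=b,\ x\in\mathbb{R}^n\}\in[-\infty,\infty).$$ Then the following hold. (i) If $\alpha^*=1$ or $\alpha^*=n$, then $F(\alpha^* )$ is a real number. (ii) If $1<\alpha^*<n$, then the function $F$ is finite and strictly decreasing on $[1,\alpha^* )$, and takes the value $-\infty$ on $(\alpha^*,n]$.
   Context: $\|\cdot\|_1$ and $\|\cdot\|_2$ are the usual $\ell_1$ and Euclidean norms on $\mathbb{R}^n$. The minimum defining $\alpha^*$ is attained, since $\mathrm{Ker}(A)\neq\{0\}$ and the constraint set is compact. $F$ is called the Dinkelbach-induced function of the problem $\inf\{\|x\|_1^2/\|x\|_2^2: Ax=b\}$. *)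

theory Defs
  imports "HOL-Analysis.Analysis"
begin

definition l1_norm :: "real ^ 'n \<Rightarrow> real"
  where "l1_norm x = (\<Sum>i\<in>UNIV. \<bar>x $ i\<bar>)"

text \<open>
  The library's \<open>norm\<close> on \<open>real ^ 'n\<close> is the Euclidean norm. The infimum below is a
  minimum whenever the kernel is nontrivial, in particular whenever \<open>A\<close> has fewer rows than
  columns: see \<open>alpha_star_attained\<close> and \<open>alpha_star_le\<close>.
\<close>
definition alpha_star :: "real ^ 'n ^ 'm \<Rightarrow> real"
  where "alpha_star A = Inf {(l1_norm v)\<^sup>2 | v. norm v = 1 \<and> A *v v = 0}"

text \<open>The infimum is taken in \<open>ereal\<close>, so that it is \<open>-\<infinity>\<close> when unbounded below.\<close>
definition dinkelbach :: "real ^ 'n ^ 'm \<Rightarrow> real ^ 'm \<Rightarrow> real \<Rightarrow> ereal"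
  where "dinkelbach A b \<alpha> = (INF x\<in>{x. A *v x = b}. ereal ((l1_norm x)\<^sup>2 - \<alpha> * (norm x)\<^sup>2))"

lemma alpha_star_le:
  assumes "norm v = 1" "A *v v = 0"
  shows "alpha_star A \<le> (l1_norm v)\<^sup>2"
  unfolding alpha_star_def
  by (rule cInf_lower) (use assms in \<open>auto intro!: bdd_belowI[of _ 0]\<close>)

lemma alpha_star_attained:
  fixes A :: "real ^ 'n ^ 'm"
  assumes "CARD('m) < CARD('n)"
  shows "\<exists>v. norm v = 1 \<and> A *v v = 0 \<and> (l1_norm v)\<^sup>2 = alpha_star A"
proof -
  let ?S = "{v. norm v = 1 \<and> A *v v = 0}"
  have S_eq: "?S = sphere 0 1 \<inter> {v. A *v v = 0}"
    by auto
  have "closed {v. A *v v = 0}"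
    by (intro closed_Collect_eq continuous_intros linear_continuous_on
        matrix_vector_mul_bounded_linear)
  then have "compact ?S"
    unfolding S_eq by (intro compact_Int_closed compact_sphere)
  moreover have "?S \<noteq> {}"
  proof -
    have "rank A \<noteq> CARD('n)"
      using rank_bound[of A] assms by simp
    then obtain w where w: "w \<noteq> 0" "A *v w = 0"
      using matrix_nonfull_linear_equations_eq[of A] by auto
    then have "(1 / norm w) *\<^sub>R w \<in> ?S"
      by (simp add: matrix_vector_mult_scaleR)
    then show ?thesis by blast
  qed
  moreover have "continuous_on ?S (\<lambda>v. (l1_norm v)\<^sup>2)"
    unfolding l1_norm_def by (intro continuous_intros)
  ultimately obtain v where v: "v \<in> ?S" "\<forall>u\<in>?S. (l1_norm v)\<^sup>2 \<le> (l1_norm u)\<^sup>2"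
    using continuous_attains_inf by blast
  have "alpha_star A = (l1_norm v)\<^sup>2"
    unfolding alpha_star_def by (rule cInf_eq_minimum) (use v in auto)
  with v show ?thesis by auto
qed

end

theory Submission
  imports Defs "HOL-Real_Asymp.Real_Asymp"
begin

text \<open>
  Any two feasible points differ by a kernel vector, and on the kernel \<open>\<alpha>\<^sup>*\<close> is the best constant
  with \<open>\<alpha>\<^sup>* \<parallel>v\<parallel>\<^sub>2\<^sup>2 \<le> \<parallel>v\<parallel>\<^sub>1\<^sup>2\<close>. So the sign of \<open>\<alpha>\<^sup>* - \<alpha>\<close> decides how the quadratic objective behaves
  at infinity on the feasible set.

  If \<open>\<alpha> > \<alpha>\<^sup>*\<close>, moving along a kernel vector that attains \<open>\<alpha>\<^sup>*\<close> drives the objective to \<open>-\<infinity>\<close>.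
  If \<open>\<alpha> < \<alpha>\<^sup>*\<close>, the inequality on the kernel carries over to feasible points up to a fixed additive
  error inside the square, and the gap \<open>\<alpha>\<^sup>* - \<alpha>\<close> absorbs this error
  (\<open>objective_bounded_below\<close>), so \<open>F\<close> is finite. It decreases strictly there because \<open>b \<noteq> 0\<close> keeps
  feasible points at a positive distance \<open>\<delta>\<close> from the origin (\<open>feasible_norm_bounded_below\<close>):
  raising \<open>\<alpha>\<close> by \<open>h\<close> lowers every objective value, hence \<open>F\<close>, by at least \<open>h \<delta>\<^sup>2\<close>.

  At \<open>\<alpha> = \<alpha>\<^sup>*\<close> the gap vanishes and the two extreme cases need their own reasons. For \<open>\<alpha>\<^sup>* = 1\<close> the
  objective is nonnegative, as \<open>\<parallel>x\<parallel>\<^sub>2 \<le> \<parallel>x\<parallel>\<^sub>1\<close>. For \<open>\<alpha>\<^sup>* = n\<close> every kernel vector attains equality in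
  the Cauchy--Schwarz inequality \<open>\<parallel>v\<parallel>\<^sub>1\<^sup>2 \<le> n \<parallel>v\<parallel>\<^sub>2\<^sup>2\<close>, so its entries all have the same modulus. This
  forces the kernel to be a line spanned by a rescaled sign vector, and the objective is then
  at least \<open>-n\<close> times the squared distance from the feasible point to that line, which is the same
  for all feasible points (\<open>objective_bounded_below_extremal\<close>).
\<close>

section \<open>The two norms\<close>

lemma l1_norm_nonneg: "0 \<le> l1_norm x"
  by (simp add: l1_norm_def sum_nonneg)

lemma l1_norm_triangle: "l1_norm (x + y) \<le> l1_norm x + l1_norm y"
  by (simp add: l1_norm_def sum_mono flip: sum.distrib)

lemma l1_norm_triangle_diff: "l1_norm (x - y) \<le> l1_norm x + l1_norm y"
  by (simp add: l1_norm_def abs_triangle_ineq4 sum_mono flip: sum.distrib)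

lemma l1_norm_scaleR: "l1_norm (c *\<^sub>R x) = \<bar>c\<bar> * l1_norm x"
  by (simp add: l1_norm_def abs_mult sum_distrib_left)

lemma norm_le_l1_norm: "norm x \<le> l1_norm x"
  unfolding l1_norm_def by (rule norm_le_l1_cart)

text \<open>
  The hypothesis is the reverse of the Cauchy--Schwarz inequality between \<open>\<bar>v\<bar>\<close> and the all-ones
  vector. It says that the variance of the numbers \<open>\<bar>v\<^sub>i\<bar>\<close> is at most zero, so they all equal their
  mean.
\<close>
lemma abs_entry_eq_mean:
  fixes v :: "real ^ 'n"
  assumes "real CARD('n) * (norm v)\<^sup>2 \<le> (l1_norm v)\<^sup>2"
  shows "\<bar>v $ i\<bar> = l1_norm v / real CARD('n)"
proof -
  let ?n = "real CARD('n)" and ?m = "l1_norm v / real CARD('n)"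
  have n: "?n > 0"
    by simp
  have norm_sq: "(\<Sum>i\<in>UNIV. (v $ i)\<^sup>2) = (norm v)\<^sup>2"
    unfolding power2_norm_eq_inner inner_vec_def by (simp add: power2_eq_square)
  have l1_sum: "(\<Sum>i\<in>UNIV. 2 * ?m * \<bar>v $ i\<bar>) = 2 * ?m * l1_norm v"
    unfolding l1_norm_def by (rule sum_distrib_left[symmetric])
  have "(\<Sum>i\<in>UNIV. (\<bar>v $ i\<bar> - ?m)\<^sup>2) = (\<Sum>i\<in>UNIV. (v $ i)\<^sup>2 - 2 * ?m * \<bar>v $ i\<bar> + ?m\<^sup>2)"
    by (intro sum.cong refl) (simp add: power2_diff)
  also have "\<dots> = (norm v)\<^sup>2 - 2 * ?m * l1_norm v + ?n * ?m\<^sup>2"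
    by (simp only: sum.distrib sum_subtractf norm_sq l1_sum sum_constant)
  also have "\<dots> = (norm v)\<^sup>2 - (l1_norm v)\<^sup>2 / ?n"
    using n by (simp add: field_simps power2_eq_square)
  also have "\<dots> \<le> 0"
    using assms n by (simp add: field_simps)
  finally have "(\<Sum>i\<in>UNIV. (\<bar>v $ i\<bar> - ?m)\<^sup>2) = 0"
    by (meson antisym sum_nonneg zero_le_power2)
  then have "(\<bar>v $ i\<bar> - ?m)\<^sup>2 = 0"
    by (subst (asm) sum_nonneg_eq_0_iff) auto
  then show ?thesis
    by simp
qed

section \<open>Bounds on the feasible set\<close>

lemma alpha_star_kernel_bound:
  assumes "A *v v = 0"
  shows "alpha_star A * (norm v)\<^sup>2 \<le> (l1_norm v)\<^sup>2"
proof (cases "v = 0")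
  case False
  have "alpha_star A \<le> (l1_norm ((1 / norm v) *\<^sub>R v))\<^sup>2"
    by (rule alpha_star_le) (use False assms in \<open>auto simp: matrix_vector_mult_scaleR\<close>)
  also have "\<dots> = (l1_norm v)\<^sup>2 / (norm v)\<^sup>2"
    by (simp add: l1_norm_scaleR power_divide)
  finally show ?thesis
    using False by (simp add: field_simps)
qed simp

lemma feasible_norm_bounded_below:
  fixes A :: "real ^ 'n ^ 'm"
  assumes "b \<noteq> 0"
  obtains \<delta> where "\<delta> > 0" "\<And>x. A *v x = b \<Longrightarrow> \<delta> \<le> norm x"
proof -
  obtain K where K: "K > 0" "\<And>x. norm (A *v x) \<le> norm x * K"
    using bounded_linear.pos_bounded[OF matrix_vector_mul_bounded_linear[of A]] by blast
  show thesis
  proof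
    show "norm b / K > 0"
      using K assms by simp
    show "norm b / K \<le> norm x" if "A *v x = b" for x
      using K(1) K(2)[of x] that by (simp add: field_simps)
  qed
qed

text \<open>
  With \<open>\<beta> = \<surd>\<alpha>\<^sup>*\<close>, comparing \<open>x\<close> with a fixed feasible point gives \<open>\<beta> \<parallel>x\<parallel>\<^sub>2 \<le> \<parallel>x\<parallel>\<^sub>1 + c\<close>. Squaring
  produces a cross term \<open>2 c \<parallel>x\<parallel>\<^sub>1\<close>, which a weighted arithmetic-geometric mean inequality splits
  into a small multiple of \<open>\<parallel>x\<parallel>\<^sub>1\<^sup>2\<close> and a constant; \<open>\<alpha> < \<alpha>\<^sup>*\<close> is what leaves room for the former.
\<close>
lemma objective_bounded_below:
  fixes A :: "real ^ 'n ^ 'm"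
  assumes "0 < \<alpha>" "\<alpha> < alpha_star A"
  obtains C where "\<And>x. A *v x = b \<Longrightarrow> C \<le> (l1_norm x)\<^sup>2 - \<alpha> * (norm x)\<^sup>2"
proof (cases "\<exists>x. A *v x = b")
  case True
  then obtain x0 where x0: "A *v x0 = b"
    by blast
  define \<beta> where "\<beta> = sqrt (alpha_star A)"
  define c where "c = l1_norm x0 + \<beta> * norm x0"
  define \<epsilon> where "\<epsilon> = alpha_star A / \<alpha> - 1"
  have \<beta>: "\<beta> > 0" "\<beta>\<^sup>2 = alpha_star A"
    using assms by (auto simp: \<beta>_def)
  have \<epsilon>: "\<epsilon> > 0" "\<alpha> * (1 + \<epsilon>) = alpha_star A"
    using assms by (auto simp: \<epsilon>_def field_simps)
  have "- ((1 + 1 / \<epsilon>) * c\<^sup>2 / (1 + \<epsilon>)) \<le> (l1_norm x)\<^sup>2 - \<alpha> * (norm x)\<^sup>2"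
    if x: "A *v x = b" for x
  proof -
    have "A *v (x - x0) = 0"
      using x x0 by (simp add: matrix_vector_mult_diff_distrib)
    then have "(\<beta> * norm (x - x0))\<^sup>2 \<le> (l1_norm (x - x0))\<^sup>2"
      using alpha_star_kernel_bound[of A "x - x0"] \<beta> by (simp add: power_mult_distrib)
    then have "\<beta> * norm (x - x0) \<le> l1_norm (x - x0)"
      by (rule power2_le_imp_le) (rule l1_norm_nonneg)
    also have "\<dots> \<le> l1_norm x + l1_norm x0"
      by (rule l1_norm_triangle_diff)
    finally have "\<beta> * norm (x - x0) \<le> l1_norm x + l1_norm x0" .
    moreover have "\<beta> * norm x \<le> \<beta> * (norm (x - x0) + norm x0)"
      using \<beta> norm_triangle_sub[of x x0] by (intro mult_left_mono) (auto simp: add.commute)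
    ultimately have "\<beta> * norm x \<le> l1_norm x + c"
      by (simp add: c_def algebra_simps)
    then have "(\<beta> * norm x)\<^sup>2 \<le> (l1_norm x + c)\<^sup>2"
      using \<beta> by (intro power_mono) auto
    also have "\<dots> \<le> (1 + \<epsilon>) * (l1_norm x)\<^sup>2 + (1 + 1 / \<epsilon>) * c\<^sup>2"
    proof -
      have "0 \<le> (\<epsilon> * l1_norm x - c)\<^sup>2 / \<epsilon>"
        using \<epsilon> by simp
      also have "\<dots> = \<epsilon> * (l1_norm x)\<^sup>2 - 2 * l1_norm x * c + c\<^sup>2 / \<epsilon>"
        using \<epsilon> by (simp add: field_simps power2_eq_square)
      finally show ?thesis
        by (simp add: power2_sum algebra_simps)
    qed
    finally have "(1 + \<epsilon>) * (\<alpha> * (norm x)\<^sup>2) \<le> (1 + \<epsilon>) * (l1_norm x)\<^sup>2 + (1 + 1 / \<epsilon>) * c\<^sup>2"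
      unfolding power_mult_distrib \<beta>(2) \<epsilon>(2)[symmetric] by (simp add: mult_ac)
    then have "(\<alpha> * (norm x)\<^sup>2 - (l1_norm x)\<^sup>2) * (1 + \<epsilon>) \<le> (1 + 1 / \<epsilon>) * c\<^sup>2"
      by (simp add: algebra_simps)
    then have "\<alpha> * (norm x)\<^sup>2 - (l1_norm x)\<^sup>2 \<le> (1 + 1 / \<epsilon>) * c\<^sup>2 / (1 + \<epsilon>)"
      using \<epsilon> by (subst pos_le_divide_eq) auto
    then show ?thesis
      by linarith
  qed
  with that show ?thesis
    by blast
qed (use that in blast)

text \<open>
  A kernel vector with a zero entry vanishes, because its entries have equal moduli; subtracting a
  multiple of a unit kernel vector \<open>v\<close> to create a zero entry shows that \<open>v\<close> spans the kernel. The
  entries of \<open>\<surd>n v\<close> are \<open>\<plusminus>1\<close>, so \<open>n (v \<bullet> x)\<^sup>2 \<le> \<parallel>x\<parallel>\<^sub>1\<^sup>2\<close>, and \<open>\<parallel>x\<parallel>\<^sub>2\<^sup>2 - (v \<bullet> x)\<^sup>2\<close> is the squared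
  distance from \<open>x\<close> to the kernel.
\<close>
lemma objective_bounded_below_extremal:
  fixes A :: "real ^ 'n ^ 'm"
  assumes "CARD('m) < CARD('n)" and extremal: "alpha_star A = real CARD('n)"
  obtains C where "\<And>x. A *v x = b \<Longrightarrow> C \<le> (l1_norm x)\<^sup>2 - real CARD('n) * (norm x)\<^sup>2"
proof (cases "\<exists>x. A *v x = b")
  case True
  then obtain x0 where x0: "A *v x0 = b"
    by blast
  let ?n = "real CARD('n)"
  obtain v where v: "norm v = 1" "A *v v = 0" "(l1_norm v)\<^sup>2 = ?n"
    using alpha_star_attained[OF assms(1), of A] extremal by auto
  have modulus: "\<bar>w $ i\<bar> = l1_norm w / ?n" if "A *v w = 0" for w i
    by (rule abs_entry_eq_mean) (use alpha_star_kernel_bound[OF that] extremal in simp)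
  have l1_pos: "l1_norm v > 0"
    using norm_le_l1_norm[of v] v by simp
  have spans: "\<exists>c. w = c *\<^sub>R v" if w: "A *v w = 0" for w
  proof -
    fix i :: 'n
    define u where "u = w - (w $ i / v $ i) *\<^sub>R v"
    have vi: "v $ i \<noteq> 0"
      using modulus[OF v(2), of i] l1_pos by auto
    have ker: "A *v u = 0"
      using w v(2) by (simp add: u_def matrix_vector_mult_diff_distrib matrix_vector_mult_scaleR)
    have "u $ i = 0"
      using vi by (simp add: u_def)
    then have "l1_norm u = 0"
      using modulus[OF ker, of i] by simp
    then have "u = 0"
      using norm_le_l1_norm[of u] by simp
    then show ?thesis
      by (auto simp: u_def)
  qed
  have sign_bound: "?n * (v \<bullet> x)\<^sup>2 \<le> (l1_norm x)\<^sup>2" for x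
  proof -
    have "\<bar>v \<bullet> x\<bar> \<le> (\<Sum>i\<in>UNIV. \<bar>v $ i * x $ i\<bar>)"
      by (simp add: inner_vec_def sum_abs)
    also have "\<dots> = l1_norm v / ?n * l1_norm x"
      by (simp add: abs_mult modulus[OF v(2)] l1_norm_def[of x] sum_distrib_left)
    finally have "(v \<bullet> x)\<^sup>2 \<le> (l1_norm v / ?n * l1_norm x)\<^sup>2"
      by (metis abs_ge_zero power2_abs power_mono)
    also have "\<dots> = (l1_norm x)\<^sup>2 / ?n"
      using v(3) by (simp add: power_mult_distrib power_divide power2_eq_square[of ?n])
    finally show ?thesis
      by (simp add: field_simps)
  qed
  have "?n * ((v \<bullet> x0)\<^sup>2 - (norm x0)\<^sup>2) \<le> (l1_norm x)\<^sup>2 - ?n * (norm x)\<^sup>2"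
    if x: "A *v x = b" for x
  proof -
    have "A *v (x - x0) = 0"
      using x x0 by (simp add: matrix_vector_mult_diff_distrib)
    with spans obtain c where c: "x - x0 = c *\<^sub>R v"
      by blast
    have x_eq: "x = x0 + c *\<^sub>R v"
      using c by (simp add: algebra_simps)
    have vv: "v \<bullet> v = 1"
      using v(1) by (simp add: norm_eq_1)
    have "(v \<bullet> x)\<^sup>2 - (norm x)\<^sup>2 = (v \<bullet> x0)\<^sup>2 - (norm x0)\<^sup>2"
      unfolding x_eq power2_norm_eq_inner
      by (simp add: inner_add_left inner_add_right vv inner_commute[of x0 v] power2_eq_square
          algebra_simps)
    then have "?n * ((v \<bullet> x0)\<^sup>2 - (norm x0)\<^sup>2) = ?n * (v \<bullet> x)\<^sup>2 - ?n * (norm x)\<^sup>2"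
      by (metis right_diff_distrib)
    with sign_bound[of x] show ?thesis
      by linarith
  qed
  with that show ?thesis
    by blast
qed (use that in blast)

section \<open>The Dinkelbach-induced function\<close>

lemma dinkelbach_finite:
  assumes "b \<in> range ((*v) A)"
    and "\<And>x. A *v x = b \<Longrightarrow> C \<le> (l1_norm x)\<^sup>2 - \<alpha> * (norm x)\<^sup>2"
  shows "\<exists>r::real. dinkelbach A b \<alpha> = ereal r"
proof -
  obtain x0 where "A *v x0 = b"
    using assms(1) by auto
  then have "dinkelbach A b \<alpha> \<le> ereal ((l1_norm x0)\<^sup>2 - \<alpha> * (norm x0)\<^sup>2)"
    unfolding dinkelbach_def by (intro INF_lower) simp
  moreover have "ereal C \<le> dinkelbach A b \<alpha>"
    unfolding dinkelbach_def by (rule INF_greatest) (use assms(2) in simp)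
  ultimately show ?thesis
    by (cases "dinkelbach A b \<alpha>") auto
qed

text \<open>
  Finiteness at the smaller parameter is essential: at \<open>-\<infinity>\<close> the decrease by a fixed amount would
  not be visible.
\<close>
lemma dinkelbach_strict_decrease:
  fixes A :: "real ^ 'n ^ 'm"
  assumes "b \<noteq> 0" "\<alpha> < \<alpha>'" and finite: "dinkelbach A b \<alpha> = ereal r"
  shows "dinkelbach A b \<alpha>' < dinkelbach A b \<alpha>"
proof -
  obtain \<delta> where \<delta>: "\<delta> > 0" "\<And>x. A *v x = b \<Longrightarrow> \<delta> \<le> norm x"
    using feasible_norm_bounded_below[OF assms(1)] by blast
  define h where "h = (\<alpha>' - \<alpha>) * \<delta>\<^sup>2"
  have h: "h > 0"
    using assms(2) \<delta>(1) by (simp add: h_def)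
  have "dinkelbach A b \<alpha>' + ereal h \<le> dinkelbach A b \<alpha>"
    unfolding dinkelbach_def[of A b \<alpha>]
  proof (rule INF_greatest)
    fix x
    assume "x \<in> {x. A *v x = b}"
    then have x: "A *v x = b"
      by simp
    have "h \<le> (\<alpha>' - \<alpha>) * (norm x)\<^sup>2"
      unfolding h_def using assms(2) \<delta> x by (intro mult_left_mono power_mono) auto
    then have step: "(l1_norm x)\<^sup>2 - \<alpha>' * (norm x)\<^sup>2 + h \<le> (l1_norm x)\<^sup>2 - \<alpha> * (norm x)\<^sup>2"
      by (simp add: algebra_simps)
    have "dinkelbach A b \<alpha>' \<le> ereal ((l1_norm x)\<^sup>2 - \<alpha>' * (norm x)\<^sup>2)"
      unfolding dinkelbach_def by (intro INF_lower) (use x in simp)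
    then have "dinkelbach A b \<alpha>' + ereal h \<le> ereal ((l1_norm x)\<^sup>2 - \<alpha>' * (norm x)\<^sup>2) + ereal h"
      by (rule add_right_mono)
    also have "\<dots> \<le> ereal ((l1_norm x)\<^sup>2 - \<alpha> * (norm x)\<^sup>2)"
      using step by simp
    finally show "dinkelbach A b \<alpha>' + ereal h \<le> ereal ((l1_norm x)\<^sup>2 - \<alpha> * (norm x)\<^sup>2)" .
  qed
  then show ?thesis
    using h finite by (cases "dinkelbach A b \<alpha>'") auto
qed

text \<open>
  Along the ray \<open>x\<^sub>0 + t v\<close>, with \<open>v\<close> a minimiser in the definition of \<open>\<alpha>\<^sup>*\<close>, the objective is at most
  a quadratic polynomial in \<open>t\<close> with leading coefficient \<open>\<alpha>\<^sup>* - \<alpha> < 0\<close>.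
\<close>
lemma dinkelbach_minus_infinity:
  fixes A :: "real ^ 'n ^ 'm"
  assumes "CARD('m) < CARD('n)" "b \<in> range ((*v) A)" "0 \<le> \<alpha>" "alpha_star A < \<alpha>"
  shows "dinkelbach A b \<alpha> = -\<infinity>"
proof -
  obtain x0 where x0: "A *v x0 = b"
    using assms(2) by auto
  obtain v where v: "norm v = 1" "A *v v = 0" "(l1_norm v)\<^sup>2 = alpha_star A"
    using alpha_star_attained[OF assms(1)] by blast
  define \<beta> c d where "\<beta> = l1_norm v" and "c = l1_norm x0" and "d = norm x0"
  have "\<beta>\<^sup>2 - \<alpha> < 0"
    using v assms by (simp add: \<beta>_def)
  then have "filterlim (\<lambda>t. (\<beta>\<^sup>2 - \<alpha>) * t\<^sup>2 + 2 * (c * \<beta> + \<alpha> * d) * t + (c\<^sup>2 - \<alpha> * d\<^sup>2)) at_bot at_top"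
    by real_asymp
  also have "(\<lambda>t. (\<beta>\<^sup>2 - \<alpha>) * t\<^sup>2 + 2 * (c * \<beta> + \<alpha> * d) * t + (c\<^sup>2 - \<alpha> * d\<^sup>2)) =
      (\<lambda>t. (c + t * \<beta>)\<^sup>2 - \<alpha> * (t - d)\<^sup>2)"
    by (simp add: fun_eq_iff power2_eq_square algebra_simps)
  finally have lim: "filterlim (\<lambda>t. (c + t * \<beta>)\<^sup>2 - \<alpha> * (t - d)\<^sup>2) at_bot at_top" .
  have "dinkelbach A b \<alpha> \<le> ereal B" for B
  proof -
    have "\<forall>\<^sub>F t in at_top. (c + t * \<beta>)\<^sup>2 - \<alpha> * (t - d)\<^sup>2 \<le> B"
      using lim by (simp add: filterlim_at_bot)
    then have "\<forall>\<^sub>F t in at_top. (c + t * \<beta>)\<^sup>2 - \<alpha> * (t - d)\<^sup>2 \<le> B \<and> max 0 d \<le> t"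
      using eventually_ge_at_top by (rule eventually_conj)
    then obtain t where t: "(c + t * \<beta>)\<^sup>2 - \<alpha> * (t - d)\<^sup>2 \<le> B" "0 \<le> t" "d \<le> t"
      using eventually_happens'[OF trivial_limit_at_top_linorder] by fastforce
    define x where "x = x0 + t *\<^sub>R v"
    have "A *v x = b"
      using x0 v(2) by (simp add: x_def matrix_vector_right_distrib matrix_vector_mult_scaleR)
    then have "dinkelbach A b \<alpha> \<le> ereal ((l1_norm x)\<^sup>2 - \<alpha> * (norm x)\<^sup>2)"
      unfolding dinkelbach_def by (intro INF_lower) simp
    also have "\<dots> \<le> ereal ((c + t * \<beta>)\<^sup>2 - \<alpha> * (t - d)\<^sup>2)"
    proof -
      have "l1_norm x \<le> c + t * \<beta>"
        using l1_norm_triangle[of x0 "t *\<^sub>R v"] t(2)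
        by (simp add: x_def c_def \<beta>_def l1_norm_scaleR)
      then have "(l1_norm x)\<^sup>2 \<le> (c + t * \<beta>)\<^sup>2"
        by (intro power_mono l1_norm_nonneg)
      moreover have "t - d \<le> norm x"
        using norm_diff_ineq[of "t *\<^sub>R v" x0] t(2) v(1) by (simp add: x_def d_def add.commute)
      then have "\<alpha> * (t - d)\<^sup>2 \<le> \<alpha> * (norm x)\<^sup>2"
        using t(3) assms(3) by (intro mult_left_mono power_mono) auto
      ultimately show ?thesis
        by simp
    qed
    also have "\<dots> \<le> ereal B"
      using t(1) by simp
    finally show ?thesis .
  qed
  then show ?thesis
    by (rule ereal_bot)
qed

theorem proposition1:
  fixes A :: "real ^ 'n ^ 'm" and b :: "real ^ 'm"
  assumes "CARD('m) < CARD('n)"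
    and "rank A = CARD('m)"
    and "b \<noteq> 0"
    and "b \<in> range ((*v) A)"
  shows "(alpha_star A = 1 \<or> alpha_star A = real CARD('n) \<longrightarrow>
            (\<exists>r::real. dinkelbach A b (alpha_star A) = ereal r)) \<and>
         (1 < alpha_star A \<and> alpha_star A < real CARD('n) \<longrightarrow>
            (\<forall>\<alpha>\<in>{1..<alpha_star A}. \<exists>r::real. dinkelbach A b \<alpha> = ereal r) \<and>
            strict_antimono_on {1..<alpha_star A} (dinkelbach A b) \<and>
            (\<forall>\<alpha>\<in>{alpha_star A<..real CARD('n)}. dinkelbach A b \<alpha> = -\<infinity>))"
proof -
  have at_one: "\<exists>r::real. dinkelbach A b 1 = ereal r"
  proof (rule dinkelbach_finite[OF assms(4)])
    show "0 \<le> (l1_norm x)\<^sup>2 - 1 * (norm x)\<^sup>2" if "A *v x = b" for x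
      using power_mono[OF norm_le_l1_norm[of x] norm_ge_zero, of 2] by simp
  qed
  have at_card: "\<exists>r::real. dinkelbach A b (real CARD('n)) = ereal r"
    if extremal: "alpha_star A = real CARD('n)"
  proof -
    obtain C where "\<And>x. A *v x = b \<Longrightarrow> C \<le> (l1_norm x)\<^sup>2 - real CARD('n) * (norm x)\<^sup>2"
      using objective_bounded_below_extremal[OF assms(1) extremal] by blast
    then show ?thesis
      by (rule dinkelbach_finite[OF assms(4)])
  qed
  have below: "\<exists>r::real. dinkelbach A b \<alpha> = ereal r" if "\<alpha> \<in> {1..<alpha_star A}" for \<alpha>
  proof -
    have "0 < \<alpha>" "\<alpha> < alpha_star A"
      using that by auto
    then obtain C where "\<And>x. A *v x = b \<Longrightarrow> C \<le> (l1_norm x)\<^sup>2 - \<alpha> * (norm x)\<^sup>2"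
      using objective_bounded_below by blast
    then show ?thesis
      by (rule dinkelbach_finite[OF assms(4)])
  qed
  have decreasing: "strict_antimono_on {1..<alpha_star A} (dinkelbach A b)"
    using below dinkelbach_strict_decrease[OF assms(3)] by (fastforce intro: monotone_onI)
  have above: "dinkelbach A b \<alpha> = -\<infinity>" if "1 < alpha_star A" "alpha_star A < \<alpha>" for \<alpha>
    using dinkelbach_minus_infinity[OF assms(1,4)] that by simp
  show ?thesis
    using at_one at_card below decreasing above by auto
qed

end
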